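(* Let $K\subset\mathbb R^2$ be a convex body containing in its interior an equireciprocal circle $\mathcal B$ with centre $O$. Then $K$ is a disc centred at $O$.
   Context: A convex body is a compact convex set with nonempty interior. A circle $\mathcal B$ (of positive radius) in the interior of a convex body $K\subset\mathbb R^2$ is an equireciprocal circle of $K$ if there is a constant $\lambda$ such that for every chord $AB$ of $K$ (with $A,B\in\partial K$) tangent to $\mathcal B$ at a point $P$ (depending on the chord), one has $\frac{1}{|AP|}+\frac{1}{|PB|}=\lambda$. *)

theory Defs
  imports "HOL-Analysis.Analysis"
begin

definition convex_body :: "'a::euclidean_space set \<Rightarrow> bool" where
  "convex_body K \<longleftrightarrow> compact K \<and> convex K \<and> interior K \<noteq> {}"

definition is_chord :: "(real^2) set \<Rightarrow> real^2 \<Rightarrow> real^2 \<Rightarrow> bool" where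
  "is_chord K A B \<longleftrightarrow> A \<in> frontier K \<and> B \<in> frontier K \<and> A \<noteq> B"

(* Stated for the whole line AB: a secant segment may also meet the circle in a single point. *)
definition tangent_at :: "real^2 \<Rightarrow> real^2 \<Rightarrow> real^2 \<Rightarrow> real \<Rightarrow> real^2 \<Rightarrow> bool" where
  "tangent_at A B z r P \<longleftrightarrow>
     P \<in> closed_segment A B \<and> affine hull {A, B} \<inter> sphere z r = {P}"

(* The quotients are genuine: P is an interior point of K, hence differs from A and B. *)
definition equireciprocal_circle :: "(real^2) set \<Rightarrow> real^2 \<Rightarrow> real \<Rightarrow> bool" where
  "equireciprocal_circle K z r \<longleftrightarrow>
     0 < r \<and> sphere z r \<subseteq> interior K \<and>
     (\<exists>l::real. \<forall>A B P. is_chord K A B \<and> tangent_at A B z r P \<longrightarrow>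
        1 / dist A P + 1 / dist P B = l)"

end

theory Submission imports Defs
begin

text \<open>
  For an angle \<open>t\<close> let \<open>a(t)\<close> be the length, in units of the radius, of the forward half of the chord
  touching the circle at angle \<open>t\<close>. The other tangent from the endpoint of this half-chord touches at
  \<open>T(t) = t + 2 arctan a(t)\<close>, and its backward half has the same length \<open>a(t)\<close>; so the hypothesis reads
  \<open>1/a(t) + 1/a(T t) = const\<close>. Hence \<open>a\<close> is invariant under \<open>T \<circ> T\<close>, and \<open>T \<circ> T\<close> moves every point of
  the orbit of \<open>t\<close> by the same amount \<open>D(t)\<close>. By convexity \<open>T\<close> is monotone, so all orbits have the
  same rotation number, which makes \<open>D\<close> constant. With \<open>D\<close> and the sum of reciprocals known,
  the product \<open>a(t) a(T t)\<close> is also known, so \<open>a(t)\<close> can only take two values. The frontier of \<open>K\<close> is connected and thus lies at a single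
  distance from the centre.
\<close>

section \<open>The unit circle, its tangent lines and tangents from exterior points\<close>

definition unit_dir :: "real \<Rightarrow> real^2" where
  "unit_dir t = vector [cos t, sin t]"

text \<open>Coordinates normalised to the unit circle at the origin; scaling by \<open>r\<close> and
  adding \<open>z\<close> leads back to \<open>K\<close>. The signed parameter \<open>a\<close> runs
  along the tangent touching at angle \<open>t\<close>, counterclockwise when positive.\<close>

definition tangent_point :: "real \<Rightarrow> real \<Rightarrow> real^2" where
  "tangent_point t a = unit_dir t + a *\<^sub>R unit_dir (t + pi/2)"

lemma inner_unit_dir: "unit_dir s \<bullet> unit_dir t = cos (s - t)"
  by (simp add: unit_dir_def inner_vec_def sum_2 cos_diff)

lemma norm_unit_dir [simp]: "norm (unit_dir t) = 1"
  by (simp add: norm_eq_1 inner_unit_dir)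

lemma unit_dir_nonzero [simp]: "unit_dir t \<noteq> 0"
  using norm_unit_dir[of t] by fastforce

lemma unit_dir_quarter_turn: "unit_dir (t + pi/2) = vector [- sin t, cos t]"
  by (simp add: unit_dir_def cos_add sin_add)

lemma unit_dir_periodic: "unit_dir (t + 2 * pi * of_int k) = unit_dir t"
proof -
  have "sin (2 * pi * of_int k) = 0" "cos (2 * pi * of_int k) = 1"
    using sin_int_2pin[of k] cos_int_2pin[of k] by (auto simp: mult_ac)
  then show ?thesis
    by (simp add: unit_dir_def cos_add sin_add)
qed

lemma tangent_point_periodic: "tangent_point (t + 2 * pi * of_int k) a = tangent_point t a"
  using unit_dir_periodic[of t k] unit_dir_periodic[of "t + pi/2" k]
  by (simp add: tangent_point_def add_ac)

lemma unit_dir_surj: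
  assumes "norm v = 1"
  obtains t where "v = unit_dir t"
proof -
  have "(v $ 1)\<^sup>2 + (v $ 2)\<^sup>2 = 1"
    using assms by (simp add: norm_vec_def L2_set_def sum_2)
  then obtain t where "v $ 1 = cos t" "v $ 2 = sin t"
    using sincos_total_2pi by metis
  then have "v = unit_dir t"
    by (simp add: vec_eq_iff unit_dir_def forall_2)
  then show thesis ..
qed

lemma norm_tangent_point: "(norm (tangent_point t a))\<^sup>2 = 1 + a\<^sup>2"
  unfolding power2_norm_eq_inner tangent_point_def
  by (simp add: inner_add inner_unit_dir power2_eq_square cos_diff)

lemma tangent_point_affine:
  "(1 - u) *\<^sub>R tangent_point t a + u *\<^sub>R tangent_point t b = tangent_point t ((1 - u) * a + u * b)"
  by (simp add: tangent_point_def algebra_simps)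

lemma tangent_point_eq_unit_dir:
  "tangent_point t (tan \<alpha>) = (1 / cos \<alpha>) *\<^sub>R unit_dir (t + \<alpha>)" if "cos \<alpha> \<noteq> 0"
  using that unfolding tangent_point_def unit_dir_quarter_turn
  by (simp add: vec_eq_iff forall_2 unit_dir_def tan_def cos_add sin_add field_simps)

text \<open>Going forward from the touching angle \<open>t\<close> and backward from \<open>t + 2 arctan a\<close> along the two
  tangents leads to the same exterior point.\<close>

lemma tangent_point_switch:
  "tangent_point (t + 2 * arctan a) (- a) = tangent_point t a"
proof -
  have "tangent_point t (tan (arctan a)) = (1 / cos (arctan a)) *\<^sub>R unit_dir (t + arctan a)"
    by (rule tangent_point_eq_unit_dir) simp
  moreover have "tangent_point (t + 2 * arctan a) (tan (- arctan a))
      = (1 / cos (- arctan a)) *\<^sub>R unit_dir (t + 2 * arctan a + - arctan a)"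
    by (rule tangent_point_eq_unit_dir) simp
  ultimately show ?thesis by (simp add: tan_arctan add_ac)
qed

lemma exterior_tangent_point:
  assumes "norm v > 1"
  obtains t a where "a > 0" "v = tangent_point t a"
proof -
  obtain s where s: "sgn v = unit_dir s"
    by (rule unit_dir_surj[of "sgn v"]) (use assms in \<open>auto simp: norm_sgn\<close>)
  have v: "v = norm v *\<^sub>R unit_dir s"
    unfolding s[symmetric] sgn_div_norm using assms by (cases "v = 0") auto
  \<comment> \<open>The angle at the origin in the right triangle formed by the origin, the touching
    point and \<open>v\<close>; turning back by it from the direction \<open>s\<close> of
    \<open>v\<close> gives the touching angle.\<close>
  define \<alpha> where "\<alpha> = arccos (1 / norm v)"
  have bounds: "0 < 1 / norm v" "1 / norm v < 1"
    using assms less_trans[OF zero_less_one assms]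
    by (simp_all only: divide_less_eq_1_pos zero_less_divide_1_iff)
  then have c: "cos \<alpha> = 1 / norm v"
    unfolding \<alpha>_def by (intro cos_arccos) linarith+
  have "- 1 < 1 / norm v" using bounds by linarith
  then have "0 < \<alpha>"
    unfolding \<alpha>_def using bounds(2) arccos_lt_bounded by blast
  moreover have "\<alpha> < pi/2"
    unfolding \<alpha>_def using bounds arccos_less_arccos[of 0 "1 / norm v"] by simp
  ultimately have "tan \<alpha> > 0" by (rule tan_gt_zero)
  moreover have "v = tangent_point (s - \<alpha>) (tan \<alpha>)"
    using tangent_point_eq_unit_dir[of \<alpha> "s - \<alpha>"] bounds(1) v unfolding c by auto
  ultimately show thesis ..
qed

text \<open>The excess of the point over the tangent line at angle \<open>s\<close>, factored to
  show its zeros \<open>s = t\<close> and \<open>s = t + 2 * \<alpha>\<close>, where the two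
  tangents through the point touch.\<close>

lemma inner_tangent_point:
  assumes "cos \<alpha> \<noteq> 0"
  shows "tangent_point t (tan \<alpha>) \<bullet> unit_dir s - 1
    = 2 * (sin ((s - t)/2) * sin (\<alpha> - (s - t)/2)) / cos \<alpha>"
proof -
  define x where "x = (s - t) / 2"
  have "tangent_point t (tan \<alpha>) \<bullet> unit_dir s = cos (t + \<alpha> - s) / cos \<alpha>"
    using assms by (simp add: tangent_point_eq_unit_dir inner_unit_dir)
  also have "t + \<alpha> - s = \<alpha> - x - x" by (simp add: x_def field_simps)
  also have "cos (\<alpha> - x - x) / cos \<alpha> - 1 = 2 * (sin x * sin (\<alpha> - x)) / cos \<alpha>"
  proof -
    have "cos (\<alpha> - x - x) = cos (\<alpha> - x) * cos x + sin (\<alpha> - x) * sin x" by (rule cos_diff)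
    moreover have "cos \<alpha> = cos (\<alpha> - x) * cos x - sin (\<alpha> - x) * sin x"
      using cos_add[of "\<alpha> - x" x] by simp
    ultimately have "cos (\<alpha> - x - x) - cos \<alpha> = 2 * (sin x * sin (\<alpha> - x))" by algebra
    then show ?thesis
      using assms by (metis diff_divide_distrib divide_self)
  qed
  finally show ?thesis by (simp add: x_def)
qed

section \<open>Comparison of tangent arcs and sums of arctangents\<close>

lemma sin_mult_sin_div_cos_less:
  fixes x1 y1 x2 y2 :: real
  assumes "0 < x2" "x2 \<le> x1" "0 < y2" "y2 < y1" "x1 + y1 < pi/2"
  shows "sin x2 * sin y2 / cos (x2 + y2) < sin x1 * sin y1 / cos (x1 + y1)"
proof (rule frac_less)
  show "0 \<le> sin x2 * sin y2"
    using assms by (auto intro!: mult_nonneg_nonneg sin_ge_zero)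
  have "sin x2 \<le> sin x1" "sin y2 < sin y1" "0 < sin x2" "0 < sin y2"
    using assms by (auto intro!: sin_monotone_2pi_le sin_monotone_2pi sin_gt_zero)
  then show "sin x2 * sin y2 < sin x1 * sin y1"
    by (intro mult_le_less_imp_less) auto
  show "0 < cos (x1 + y1)"
    using assms by (auto intro!: cos_gt_zero_pi)
  show "cos (x1 + y1) \<le> cos (x2 + y2)"
    using assms by (intro cos_monotone_0_pi_le) auto
qed

text \<open>The cotangent is preferred to the tangent because its denominator \<open>a + b\<close>
  is positive, whereas \<open>1 - a * b\<close> may vanish.\<close>

lemma cot_add_arctan:
  assumes "a > 0" "b > 0"
  shows "cot (arctan a + arctan b) = (1 - a * b) / (a + b)"
proof -
  have "cos (arctan a + arctan b) = cos (arctan a) * cos (arctan b) * (1 - a * b)"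
    using tan_arctan[of a] tan_arctan[of b]
    by (simp add: cos_add tan_def field_simps)
  moreover have "sin (arctan a + arctan b) = cos (arctan a) * cos (arctan b) * (a + b)"
    using tan_arctan[of a] tan_arctan[of b]
    by (simp add: sin_add tan_def field_simps)
  ultimately show ?thesis by (simp add: cot_def)
qed

text \<open>With \<open>m\<close> the common sum of reciprocals, \<open>a + b = m * (a * b)\<close>,
  so the cotangent of the arctangent sum determines \<open>a * b\<close> and then
  \<open>a + b\<close>. Hence \<open>a\<close> is a root of the quadratic with roots
  \<open>c\<close> and \<open>d\<close>.\<close>

lemma pair_from_reciprocals_and_arctans:
  fixes a b c d :: real
  assumes pos: "a > 0" "b > 0" "c > 0" "d > 0"
    and recip: "1/a + 1/b = 1/c + 1/d"
    and arctans: "arctan a + arctan b = arctan c + arctan d"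
  shows "a = c \<or> a = d"
proof -
  define m where "m = 1/a + 1/b"
  have "m > 0" using pos by (simp add: m_def add_pos_pos)
  have ab: "a + b = m * (a * b)"
    using pos by (simp add: m_def field_simps)
  have cd: "c + d = m * (c * d)"
    using pos unfolding m_def recip by (simp add: field_simps)
  have "(1 - a * b) / (a + b) = (1 - c * d) / (c + d)"
    using pos arctans cot_add_arctan by metis
  then have prod: "a * b = c * d"
    unfolding ab cd using pos \<open>m > 0\<close> by (simp add: field_simps)
  then have "a + b = c + d" using ab cd by simp
  with prod have "(a - c) * (a - d) = 0" by algebra
  then show ?thesis by simp
qed

section \<open>Half-chords tangent to an equireciprocal circle\<close>

locale equireciprocal =
  fixes K :: "(real^2) set" and z :: "real^2" and r l :: real
  assumes compact: "compact K" and convex: "convex K"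
    and r_pos: "r > 0" and sphere_interior: "sphere z r \<subseteq> interior K"
    and reciprocal: "\<And>A B P. is_chord K A B \<Longrightarrow> tangent_at A B z r P \<Longrightarrow>
      1 / dist A P + 1 / dist P B = l"
begin

definition forward :: "real \<Rightarrow> real \<Rightarrow> bool" where
  "forward t a \<longleftrightarrow> 0 < a \<and> z + r *\<^sub>R tangent_point t a \<in> frontier K"

definition backward :: "real \<Rightarrow> real \<Rightarrow> bool" where
  "backward t b \<longleftrightarrow> 0 < b \<and> z + r *\<^sub>R tangent_point t (- b) \<in> frontier K"

text \<open>The function \<open>a\<close> of the overview, with \<open>step\<close> as its
  \<open>T\<close>. The choice is unambiguous by \<open>forward_unique\<close>.\<close>

definition len :: "real \<Rightarrow> real" where
  "len t = (SOME a. forward t a)"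

definition step :: "real \<Rightarrow> real" where
  "step t = t + 2 * arctan (len t)"

lemma circle_point_interior: "z + r *\<^sub>R unit_dir t \<in> interior K"
  using sphere_interior r_pos by (auto simp: dist_norm)

lemma ray_frontier:
  assumes "v \<noteq> 0"
  obtains d where "d > 0" "z + r *\<^sub>R (unit_dir t + d *\<^sub>R v) \<in> frontier K"
proof -
  obtain d where "d > 0" "z + r *\<^sub>R unit_dir t + d *\<^sub>R (r *\<^sub>R v) \<in> frontier K"
    using ray_to_frontier[OF compact_imp_bounded[OF compact] circle_point_interior, of "r *\<^sub>R v" t]
      assms r_pos by auto
  then show thesis using that[of d] by (simp add: algebra_simps)
qed

lemma ex_forward: "\<exists>a. forward t a"
  using ray_frontier[of "unit_dir (t + pi/2)" t]
  unfolding forward_def tangent_point_def by auto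

lemma ex_backward: "\<exists>b. backward t b"
  using ray_frontier[of "- unit_dir (t + pi/2)" t]
  unfolding backward_def tangent_point_def by auto

lemma forward_len: "forward t (len t)"
  unfolding len_def using ex_forward by (rule someI_ex)

lemma len_pos: "len t > 0"
  using forward_len by (simp add: forward_def)

text \<open>The true half-chords have lengths \<open>r * a\<close> and \<open>r * b\<close>, which
  accounts for the factor \<open>r\<close> on the right.\<close>

lemma forward_backward_reciprocal:
  assumes "forward t a" "backward t b"
  shows "1/a + 1/b = r * l"
proof -
  let ?A = "z + r *\<^sub>R tangent_point t a" and ?B = "z + r *\<^sub>R tangent_point t (- b)"
    and ?P = "z + r *\<^sub>R tangent_point t 0"
  have pos: "a > 0" "b > 0" using assms by (auto simp: forward_def backward_def)
  have comb: "(1 - u) *\<^sub>R ?A + u *\<^sub>R ?B = z + r *\<^sub>R tangent_point t ((1 - u) * a + u * (- b))" for u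
    unfolding tangent_point_affine[symmetric] by (simp add: algebra_simps)
  have diff: "tangent_point t c - tangent_point t d = (c - d) *\<^sub>R unit_dir (t + pi/2)" for c d
    by (simp add: tangent_point_def algebra_simps)
  have dist: "dist (z + r *\<^sub>R tangent_point t c) (z + r *\<^sub>R tangent_point t d) = r * \<bar>c - d\<bar>" for c d
    using r_pos by (simp add: dist_norm flip: scaleR_diff_right) (simp add: diff)
  have "dist ?A ?B \<noteq> 0" unfolding dist using pos r_pos by simp
  then have chord: "is_chord K ?A ?B"
    using assms by (auto simp: is_chord_def forward_def backward_def)
  \<comment> \<open>Along the chord the tangent parameter runs affinely from \<open>a\<close> to
    \<open>- b\<close> and vanishes at weight \<open>a / (a + b)\<close>.\<close>
  have P: "?P = (1 - a / (a + b)) *\<^sub>R ?A + (a / (a + b)) *\<^sub>R ?B"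
  proof -
    have "(1 - a / (a + b)) * a + (a / (a + b)) * (- b) = 0"
      using pos by (simp add: field_simps)
    then show ?thesis unfolding comb by simp
  qed
  have "?P \<in> closed_segment ?A ?B"
    unfolding in_segment using pos P by (intro exI[of _ "a / (a + b)"]) auto
  moreover have "affine hull {?A, ?B} \<inter> sphere z r = {?P}"
  proof (intro equalityI subsetI)
    fix x assume x: "x \<in> affine hull {?A, ?B} \<inter> sphere z r"
    then obtain u v where "x = u *\<^sub>R ?A + v *\<^sub>R ?B" "u + v = 1"
      unfolding affine_hull_2 by auto
    moreover from this have "u = 1 - v" by simp
    ultimately obtain c where c: "x = z + r *\<^sub>R tangent_point t c"
      using comb[of v] by metis
    have "norm (tangent_point t c) = 1"
      using x r_pos unfolding c by (simp add: dist_norm)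
    then have "c = 0" using norm_tangent_point[of t c] by simp
    then show "x \<in> {?P}" using c by simp
  next
    fix x assume "x \<in> {?P}"
    moreover have "?P \<in> affine hull {?A, ?B}"
      unfolding affine_hull_2 using P by (intro CollectI exI[of _ "1 - a / (a + b)"] exI[of _ "a / (a + b)"]) auto
    moreover have "?P \<in> sphere z r"
      using r_pos by (simp add: dist_norm tangent_point_def)
    ultimately show "x \<in> affine hull {?A, ?B} \<inter> sphere z r" by blast
  qed
  ultimately have "tangent_at ?A ?B z r ?P" by (simp add: tangent_at_def)
  from reciprocal[OF chord this] show ?thesis
    unfolding dist using pos r_pos by (simp add: field_simps)
qed

text \<open>All candidates are paired with the same backward half-chord, so their reciprocals
  agree.\<close>

lemma forward_unique: "forward t a \<Longrightarrow> a = len t"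
proof -
  assume "forward t a"
  moreover obtain b where "backward t b" using ex_backward by blast
  ultimately have "1 / a = 1 / len t"
    using forward_backward_reciprocal forward_len by (metis add_right_cancel)
  then show ?thesis by simp
qed

lemma backward_step: "backward (step t) (len t)"
  using forward_len[of t] by (simp add: forward_def backward_def step_def tangent_point_switch)

lemma reciprocal_step: "1 / len (step t) + 1 / len t = r * l"
  by (rule forward_backward_reciprocal[OF forward_len backward_step])

text \<open>The lengths at \<open>t\<close> and at \<open>step (step t)\<close> both complete the
  one at \<open>step t\<close> to the same sum of reciprocals.\<close>

lemma len_step_step: "len (step (step t)) = len t"
proof -
  have "1 / len (step (step t)) = 1 / len t"
    using reciprocal_step[of t] reciprocal_step[of "step t"] by linarith
  then show ?thesis by simp
qed

lemma len_periodic: "len (t + 2 * pi * of_int k) = len t"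
  unfolding len_def forward_def by (simp add: tangent_point_periodic)

lemma step_periodic: "step (t + 2 * pi * of_int k) = step t + 2 * pi * of_int k"
  by (simp add: step_def len_periodic)

text \<open>If the tangent arc of an endpoint \<open>A\<^sub>2\<close> were nested inside that of \<open>A\<^sub>1\<close>, then \<open>A\<^sub>2\<close> would lie in the
  interior of the convex hull of \<open>A\<^sub>1\<close> and the disc. A supporting line of \<open>K\<close> at \<open>A\<^sub>2\<close> shows that this
  is impossible.\<close>

lemma step_mono:
  assumes "t1 \<le> t2"
  shows "step t1 \<le> step t2"
proof (rule ccontr)
  assume "\<not> step t1 \<le> step t2"
  then have less: "step t2 < step t1" by simp
  define \<alpha>1 \<alpha>2 where "\<alpha>1 = arctan (len t1)" and "\<alpha>2 = arctan (len t2)"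
  have \<alpha>: "0 < \<alpha>1" "\<alpha>1 < pi/2" "0 < \<alpha>2" "\<alpha>2 < pi/2"
    using len_pos arctan_ubound by (auto simp: \<alpha>1_def \<alpha>2_def)
  have c: "cos \<alpha>1 > 0" "cos \<alpha>2 > 0" using \<alpha> by (auto intro!: cos_gt_zero)
  have len: "len t1 = tan \<alpha>1" "len t2 = tan \<alpha>2"
    by (simp_all add: \<alpha>1_def \<alpha>2_def tan_arctan)
  let ?A1 = "z + r *\<^sub>R tangent_point t1 (tan \<alpha>1)" and ?A2 = "z + r *\<^sub>R tangent_point t2 (tan \<alpha>2)"
  have front: "?A1 \<in> frontier K" "?A2 \<in> frontier K"
    using forward_len by (auto simp: forward_def simp flip: len)
  have inK: "?A1 \<in> K" "?A2 \<in> K"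
    using front compact by (auto simp: frontier_def compact_imp_closed)
  have "?A2 \<notin> rel_interior K"
    using front circle_point_interior rel_interior_nonempty_interior[of K]
    by (auto simp: frontier_def)
  then obtain w where w: "w \<noteq> 0" "\<And>y. y \<in> K \<Longrightarrow> w \<bullet> ?A2 \<le> w \<bullet> y"
      "\<And>y. y \<in> rel_interior K \<Longrightarrow> w \<bullet> ?A2 < w \<bullet> y"
    using supporting_hyperplane_rel_boundary[OF convex inK(2)] by metis
  \<comment> \<open>The supporting functional \<open>w\<close> is smallest at \<open>?A2\<close>, so
    \<open>- w\<close> is an outer normal there.\<close>
  obtain s0 where s0: "sgn (- w) = unit_dir s0"
    using unit_dir_surj[of "sgn (- w)"] w(1) by (auto simp: norm_sgn)
  \<comment> \<open>Full turns are removed so that the normal angle \<open>s\<close> lies within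
    \<open>pi\<close> of \<open>t2 + \<alpha>2\<close>, the direction of \<open>?A2\<close> from the
    centre; there the cosine inequality can be inverted.\<close>
  define k where "k = \<lfloor>(s0 - (t2 + \<alpha>2) + pi) / (2 * pi)\<rfloor>"
  define s where "s = s0 + 2 * pi * of_int (- k)"
  have w_s: "w = - (norm w *\<^sub>R unit_dir s)"
    unfolding s_def unit_dir_periodic using w(1) by (simp flip: s0 add: sgn_div_norm)
  have sA1: "unit_dir s \<bullet> tangent_point t1 (tan \<alpha>1) \<le> unit_dir s \<bullet> tangent_point t2 (tan \<alpha>2)"
    using w(2)[OF inK(1)] w(1) r_pos by (subst (asm) (1 2) w_s) (simp add: inner_add_right)
  have "z + r *\<^sub>R unit_dir s \<in> rel_interior K"
    using circle_point_interior interior_subset_rel_interior by blast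
  \<comment> \<open>The circle lies strictly on the inner side of the supporting line, which forces
    \<open>s\<close> into the open arc from \<open>t2\<close> to \<open>step t2\<close>.\<close>
  from w(3)[OF this] have "1 < unit_dir s \<bullet> tangent_point t2 (tan \<alpha>2)"
    using w(1) r_pos by (subst (asm) (1 2) w_s) (simp add: inner_add_right inner_unit_dir)
  moreover have "unit_dir s \<bullet> tangent_point t2 (tan \<alpha>2) = cos (s - (t2 + \<alpha>2)) / cos \<alpha>2"
    using c by (simp add: tangent_point_eq_unit_dir inner_unit_dir)
  ultimately have "cos \<alpha>2 < cos \<bar>s - (t2 + \<alpha>2)\<bar>" using c by (simp add: field_simps)
  moreover have "\<bar>s - (t2 + \<alpha>2)\<bar> \<le> pi"
  proof -
    have "of_int k \<le> (s0 - (t2 + \<alpha>2) + pi) / (2 * pi)" "(s0 - (t2 + \<alpha>2) + pi) / (2 * pi) < of_int k + 1"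
      unfolding k_def by linarith+
    then have "of_int k * (2 * pi) \<le> s0 - (t2 + \<alpha>2) + pi"
        "s0 - (t2 + \<alpha>2) + pi < (of_int k + 1) * (2 * pi)"
      by (simp_all add: pos_le_divide_eq pos_divide_less_eq)
    then show ?thesis unfolding s_def by (simp add: abs_le_iff algebra_simps)
  qed
  ultimately have near: "\<bar>s - (t2 + \<alpha>2)\<bar> < \<alpha>2"
    using \<alpha> by (subst (asm) cos_mono_less_eq) auto
  \<comment> \<open>The four factors measure half the gaps from \<open>s\<close> to the ends of the
    two arcs. Nesting makes those of the outer arc at least as large, and strictly so at its forward
    end; thus \<open>?A1\<close> would lie beyond the supporting line.\<close>
  have "sin ((s - t2)/2) * sin (\<alpha>2 - (s - t2)/2) / cos ((s - t2)/2 + (\<alpha>2 - (s - t2)/2))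
      < sin ((s - t1)/2) * sin (\<alpha>1 - (s - t1)/2) / cos ((s - t1)/2 + (\<alpha>1 - (s - t1)/2))"
    using near \<alpha> assms less unfolding step_def \<alpha>1_def[symmetric] \<alpha>2_def[symmetric]
    by (intro sin_mult_sin_div_cos_less) (auto simp: abs_less_iff field_simps)
  then have "tangent_point t2 (tan \<alpha>2) \<bullet> unit_dir s < tangent_point t1 (tan \<alpha>1) \<bullet> unit_dir s"
    using inner_tangent_point[of \<alpha>1 t1 s] inner_tangent_point[of \<alpha>2 t2 s] c by simp
  then show False using sA1 by (simp add: inner_commute)
qed

section \<open>Constancy of the displacement under the double step\<close>

definition displacement :: "real \<Rightarrow> real" where
  "displacement t = 2 * (arctan (len t) + arctan (len (step t)))"

lemma step_step: "step (step t) = t + displacement t"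
  by (simp add: displacement_def step_def)

lemma displacement_step_step: "displacement (step (step t)) = displacement t"
  by (simp add: displacement_def len_step_step)

lemma displacement_periodic: "displacement (t + 2 * pi * of_int k) = displacement t"
  by (simp add: displacement_def step_periodic len_periodic)

text \<open>The displacement is the same all along the orbit, so every double step adds the same
  amount.\<close>

lemma iterate_step_step: "((step \<circ> step) ^^ n) t = t + of_nat n * displacement t"
proof (induction n)
  case (Suc n)
  have "displacement (((step \<circ> step) ^^ n) t) = displacement t"
    by (induction n) (simp_all add: displacement_step_step)
  moreover have "((step \<circ> step) ^^ Suc n) t
      = ((step \<circ> step) ^^ n) t + displacement (((step \<circ> step) ^^ n) t)"
    by (simp add: step_step)
  ultimately show ?case using Suc by (simp add: distrib_right)
qed simp

text \<open>Otherwise \<open>t1\<close>, moved by full turns to the left of \<open>t2\<close>, would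
  start an orbit that advances faster and overtakes that of \<open>t2\<close>, against monotonicity.
  Exchanging the arguments gives equality.\<close>

lemma displacement_le: "displacement t1 \<le> displacement t2"
proof (rule ccontr)
  assume "\<not> displacement t1 \<le> displacement t2"
  then have pos: "displacement t1 - displacement t2 > 0" by simp
  define k where "k = \<lfloor>(t2 - t1) / (2 * pi)\<rfloor>"
  define t where "t = t1 + 2 * pi * of_int k"
  have "of_int k \<le> (t2 - t1) / (2 * pi)" by (simp add: k_def)
  then have "t \<le> t2" by (simp add: t_def field_simps)
  have mono: "((step \<circ> step) ^^ n) t \<le> ((step \<circ> step) ^^ n) t2" for n
    using \<open>t \<le> t2\<close> by (induction n) (auto intro: step_mono)
  obtain n :: nat where "t2 - t < of_nat n * (displacement t1 - displacement t2)"
    using reals_Archimedean3[OF pos] by blast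
  then show False
    using mono[of n] displacement_periodic[of t1 k]
    by (simp add: iterate_step_step t_def algebra_simps)
qed

lemma len_two_values: "len t = len 0 \<or> len t = len (step 0)"
proof (rule pair_from_reciprocals_and_arctans)
  show "1 / len t + 1 / len (step t) = 1 / len 0 + 1 / len (step 0)"
    using reciprocal_step[of t] reciprocal_step[of 0] by linarith
  show "arctan (len t) + arctan (len (step t)) = arctan (len 0) + arctan (len (step 0))"
    using displacement_le[of t 0] displacement_le[of 0 t] by (simp add: displacement_def)
qed (auto intro: len_pos)

section \<open>The frontier lies on a single circle\<close>

lemma center_interior: "z \<in> interior K"
proof -
  have "(1/2) *\<^sub>R (z + r *\<^sub>R unit_dir 0) + (1/2) *\<^sub>R (z + r *\<^sub>R unit_dir pi) \<in> interior K"
    using convex_interior[OF convex] circle_point_interior[of 0] circle_point_interior[of pi]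
    by (intro convexD) auto
  moreover have "unit_dir pi = - unit_dir 0"
    by (simp add: unit_dir_def vec_eq_iff forall_2)
  ultimately show ?thesis
    by (simp add: scaleR_right_distrib scaleR_right_diff_distrib flip: scaleR_left_distrib)
qed

text \<open>The closed disc is the convex hull of its circle, so convexity of the interior of
  \<open>K\<close> puts the whole disc inside it.\<close>

lemma frontier_outside:
  assumes "Q \<in> frontier K"
  shows "dist z Q > r"
proof (rule ccontr)
  assume "\<not> dist z Q > r"
  then have "Q \<in> cball z r" by simp
  also have "cball z r = convex hull sphere z r"
    using Krein_Milman_frontier[of "cball z r"] r_pos by simp
  also have "\<dots> \<subseteq> interior K"
    by (rule hull_minimal) (use sphere_interior convex convex_interior in auto)
  finally show False using assms by (simp add: frontier_def)
qed

lemma frontier_forward: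
  assumes "Q \<in> frontier K"
  obtains t where "Q = z + r *\<^sub>R tangent_point t (len t)"
proof -
  have "norm ((Q - z) /\<^sub>R r) > 1"
    using frontier_outside[OF assms] r_pos
    by (simp add: dist_norm norm_minus_commute flip: divide_inverse_commute)
  then obtain t a where ta: "a > 0" "(Q - z) /\<^sub>R r = tangent_point t a"
    by (rule exterior_tangent_point)
  then have "r *\<^sub>R ((Q - z) /\<^sub>R r) = r *\<^sub>R tangent_point t a" by simp
  then have Q: "Q = z + r *\<^sub>R tangent_point t a" using r_pos by (simp add: algebra_simps)
  then have "forward t a" using assms ta by (simp add: forward_def)
  then show thesis using that Q forward_unique by blast
qed

lemma connected_frontier: "connected (frontier K)"
proof -
  have "interior K \<noteq> {}" using center_interior by blast
  then show ?thesis
    using connected_sphere_gen[OF convex compact_imp_bounded[OF compact]]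
    by (simp add: aff_dim_nonempty_interior rel_frontier_nonempty_interior)
qed

text \<open>The distance from the centre depends only on the half-chord length, which takes at most
  two values; a finite connected set of reals has at most one point.\<close>

lemma frontier_equidistant: "\<exists>R. frontier K \<subseteq> sphere z R"
proof -
  have "dist z ` frontier K \<subseteq> (\<lambda>a. r * sqrt (1 + a\<^sup>2)) ` {len 0, len (step 0)}"
  proof
    fix d assume "d \<in> dist z ` frontier K"
    then obtain t where t: "d = dist z (z + r *\<^sub>R tangent_point t (len t))"
      by (auto elim: frontier_forward)
    have "norm (tangent_point t (len t)) = sqrt (1 + (len t)\<^sup>2)"
      by (metis norm_tangent_point norm_ge_zero real_sqrt_unique)
    then have "d = r * sqrt (1 + (len t)\<^sup>2)"
      using r_pos t by (simp add: dist_norm)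
    then show "d \<in> (\<lambda>a. r * sqrt (1 + a\<^sup>2)) ` {len 0, len (step 0)}"
      using len_two_values[of t] by auto
  qed
  then have "finite (dist z ` frontier K)" by (rule finite_subset) simp
  moreover have "connected (dist z ` frontier K)"
    by (intro connected_continuous_image connected_frontier continuous_intros)
  ultimately obtain R where "dist z ` frontier K \<subseteq> {R}"
    using connected_finite_iff_sing[of "dist z ` frontier K"] by (metis empty_subsetI order_refl)
  then have "frontier K \<subseteq> sphere z R" by auto
  then show ?thesis ..
qed

end

text \<open>One inclusion holds because \<open>K\<close> is the hull of its frontier. For the other,
  the segment from \<open>z\<close> to a missing point of the ball crosses the frontier at distance
  \<open>R\<close> already, so the crossing is the missing point itself.\<close>

lemma convex_body_eq_cball:
  fixes K :: "'a::euclidean_space set"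
  assumes "compact K" "convex K" "z \<in> interior K" and frontier: "frontier K \<subseteq> sphere z R"
  shows "K = cball z R"
proof
  have "K = convex hull (frontier K)"
    using assms by (intro Krein_Milman_frontier)
  also have "\<dots> \<subseteq> cball z R"
    by (rule hull_minimal) (use frontier in auto)
  finally show "K \<subseteq> cball z R" .
  show "cball z R \<subseteq> K"
  proof (rule ccontr)
    assume "\<not> cball z R \<subseteq> K"
    then obtain x where x: "dist z x \<le> R" "x \<notin> K" by (meson mem_cball subsetI)
    have "z \<in> K" using assms interior_subset by blast
    have "closed_segment z x \<inter> frontier K \<noteq> {}"
      by (rule connected_Int_frontier) (use x \<open>z \<in> K\<close> in auto)
    then obtain y where y: "y \<in> closed_segment z x" "y \<in> frontier K" by blast
    then have "y \<in> K" using \<open>compact K\<close> by (auto simp: frontier_def compact_imp_closed)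
    have "dist z y = R" using y frontier by auto
    moreover have "dist z x = dist z y + dist y x"
      using y by (simp flip: between_mem_segment between)
    ultimately have "x = y" using x zero_le_dist[of y x] by simp
    then show False using x \<open>y \<in> K\<close> by simp
  qed
qed

theorem theorem8:
  fixes K :: "(real^2) set" and z :: "real^2" and r :: real
  assumes "convex_body K"
    and "equireciprocal_circle K z r"
  shows "\<exists>R>0. K = cball z R"
proof -
  have "compact K" "convex K"
    using assms(1) by (simp_all add: convex_body_def)
  moreover have "r > 0" "sphere z r \<subseteq> interior K"
    using assms(2) by (simp_all add: equireciprocal_circle_def)
  moreover obtain l where "\<And>A B P. is_chord K A B \<Longrightarrow> tangent_at A B z r P \<Longrightarrow>
      1 / dist A P + 1 / dist P B = l"
    using assms(2) unfolding equireciprocal_circle_def by metis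
  ultimately interpret equireciprocal K z r l
    by (rule equireciprocal.intro)
  obtain R where "frontier K \<subseteq> sphere z R" using frontier_equidistant ..
  then have K: "K = cball z R"
    using convex_body_eq_cball compact convex center_interior by blast
  \<comment> \<open>So far \<open>R\<close> is an arbitrary real; the interior point
    \<open>z\<close> of the ball excludes \<open>R \<le> 0\<close>.\<close>
  then have "R > 0" using center_interior by (simp add: interior_cball)
  then show ?thesis using K by blast
qed

end
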